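(* For $k \ge 0$ let $n = 2^k$ and let $D_n$ be the $n\times n$ Boolean matrix with rows and columns indexed by $0,1,\dots,2^k-1$, whose entry $(i,j)$ equals $1$ if and only if the binary expansions of $i$ and $j$ have no common $1$ (i.e., the corresponding subsets of $\{1,\dots,k\}$ are disjoint), and $0$ otherwise. Then $\mathsf{OR_2}(D_n) \le n^{\log_2(9/4)} \cdot \mathrm{polylog}(n)$; that is, there is a constant $c$ such that $\mathsf{OR_2}(D_n) \le n^{\log_2(9/4)} (\log_2 n + 2)^c$ for all $n = 2^k$.
   Context: A rectifier network with $m$ inputs and $n$ outputs is a tuple $(V,E,\mathsf{in},\mathsf{out})$ where $(V,E)$ is a directed acyclic graph, and $\mathsf{in}\colon\{1,\dots,n\}\to V$ and $\mathsf{out}\colon\{1,\dots,m\}\to V$ are injective maps whose images consist only of sources (respectively, only of sinks) of the graph. Its size is $|E|$. It expresses the Boolean $m\times n$ matrix $M$ with $M_{ij}=1$ iff there is a directed path from $\mathsf{in}(j)$ to $\mathsf{out}(i)$. It has depth $2$ if all maximal paths have exactly $2$ edges. For a Boolean matrix $A$, $\mathsf{OR_2}(A)$ is the smallest size of a depth-$2$ rectifier network expressing $A$ (equivalently, the minimum of $\sum(|R|+|C|)$ over all collections of all-$1$ submatrices $R\times C$ of $A$ whose union covers all $1$-entries of $A$). *)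

theory Defs
  imports Complex_Main "HOL-Library.Sublist" "Jordan_Normal_Form.Matrix"
begin

record 'v rectifier_network =
  verts :: "'v set"
  edges :: "('v \<times> 'v) set"
  inp :: "nat \<Rightarrow> 'v"
  outp :: "nat \<Rightarrow> 'v"

definition is_source :: "('v \<times> 'v) set \<Rightarrow> 'v \<Rightarrow> bool" where
  "is_source E v \<longleftrightarrow> (\<nexists>u. (u, v) \<in> E)"

definition is_sink :: "('v \<times> 'v) set \<Rightarrow> 'v \<Rightarrow> bool" where
  "is_sink E v \<longleftrightarrow> (\<nexists>w. (v, w) \<in> E)"

text \<open>A network for \<open>m \<times> n\<close> matrices has one input per column and one output per row.
  Indices are 0-based, as for the library's matrices.\<close>

definition is_network :: "nat \<Rightarrow> nat \<Rightarrow> 'v rectifier_network \<Rightarrow> bool" where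
  "is_network m n N \<longleftrightarrow>
     finite (verts N) \<and> edges N \<subseteq> verts N \<times> verts N \<and> acyclic (edges N) \<and>
     inj_on (inp N) {..<n} \<and> inp N ` {..<n} \<subseteq> {v \<in> verts N. is_source (edges N) v} \<and>
     inj_on (outp N) {..<m} \<and> outp N ` {..<m} \<subseteq> {v \<in> verts N. is_sink (edges N) v}"

definition network_size :: "'v rectifier_network \<Rightarrow> nat" where
  "network_size N = card (edges N)"

text \<open>Paths are given by their vertex sequences and have at least one edge. Hence an isolated
  vertex is not a maximal path, so that matrices with zero rows or columns also have depth-2
  networks, and a vertex that is both an input and an output does not connect to itself.
  In an acyclic graph there is no difference between walks and paths.\<close>

definition is_path :: "('v \<times> 'v) set \<Rightarrow> 'v list \<Rightarrow> bool" where
  "is_path E p \<longleftrightarrow> 2 \<le> length p \<and> successively (\<lambda>u v. (u, v) \<in> E) p"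

definition is_maximal_path :: "('v \<times> 'v) set \<Rightarrow> 'v list \<Rightarrow> bool" where
  "is_maximal_path E p \<longleftrightarrow> is_path E p \<and> (\<forall>q. is_path E q \<and> sublist p q \<longrightarrow> q = p)"

definition has_depth :: "'v rectifier_network \<Rightarrow> nat \<Rightarrow> bool" where
  "has_depth N d \<longleftrightarrow> (\<forall>p. is_maximal_path (edges N) p \<longrightarrow> length p = d + 1)"

definition expresses :: "'v rectifier_network \<Rightarrow> bool mat \<Rightarrow> bool" where
  "expresses N M \<longleftrightarrow> is_network (dim_row M) (dim_col M) N \<and>
     (\<forall>i < dim_row M. \<forall>j < dim_col M.
        M $$ (i, j) \<longleftrightarrow> (\<exists>p. is_path (edges N) p \<and> hd p = inp N j \<and> last p = outp N i))"

text \<open>As networks are finite, it is no restriction to take natural numbers as vertices. The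
  minimum ranges over a nonempty set by \<open>ex_depth2_network\<close> below.\<close>

definition OR2 :: "bool mat \<Rightarrow> nat" where
  "OR2 A = (LEAST s. \<exists>N :: nat rectifier_network.
     expresses N A \<and> has_depth N 2 \<and> network_size N = s)"

definition disjointness_mat :: "nat \<Rightarrow> bool mat" where
  "disjointness_mat n = mat n n (\<lambda>(i, j). \<not> (\<exists>b. bit i b \<and> bit j b))"

lemma ex_depth2_network: "\<exists>N :: nat rectifier_network. expresses N A \<and> has_depth N 2"
proof -
  define m n where "m = dim_row A" and "n = dim_col A"
  define S where "S = {(i, j). i < m \<and> j < n \<and> A $$ (i, j)}"
  define mid where "mid = (\<lambda>i j. m + n + (i * n + j))"
  define E where "E = (\<lambda>(i, j). (j, mid i j)) ` S \<union> (\<lambda>(i, j). (mid i j, n + i)) ` S"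
  define N where "N = \<lparr>verts = {..<m + n + m * n}, edges = E, inp = (\<lambda>j. j), outp = (\<lambda>i. n + i)\<rparr>"
  have mid_lt: "mid i j < m + n + m * n" if "i < m" "j < n" for i j
  proof -
    have "i * n + j < Suc i * n" using that by simp
    also have "\<dots> \<le> m * n" using that by (intro mult_le_mono1) simp
    finally show ?thesis by (simp add: mid_def)
  qed
  have mid_inj: "i = i' \<and> j = j'" if "mid i j = mid i' j'" "j < n" "j' < n" for i j i' j'
  proof -
    have eq: "i * n + j = i' * n + j'" using that by (simp add: mid_def)
    have "(i * n + j) div n = i" "(i' * n + j') div n = i'" using that by auto
    with eq show ?thesis by auto
  qed
  have E_cases: "(\<exists>i j. (i, j) \<in> S \<and> u = j \<and> v = mid i j) \<or>
      (\<exists>i j. (i, j) \<in> S \<and> u = mid i j \<and> v = n + i)" if "(u, v) \<in> E" for u v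
    using that by (auto simp: E_def)
  have S_D: "i < m" "j < n" "A $$ (i, j)" if "(i, j) \<in> S" for i j
    using that by (auto simp: S_def)
  have mid_ge: "m + n \<le> mid i j" for i j by (simp add: mid_def)
  have no_in: "(u, v) \<notin> E" if "v < n" for u v
  proof
    assume "(u, v) \<in> E"
    from E_cases[OF this] obtain i j where "v = mid i j \<or> v = n + i" by blast
    then show False using mid_ge[of i j] that by linarith
  qed
  have out_mid: "u = mid i j \<Longrightarrow> (u, v) \<in> E \<Longrightarrow> j < n \<Longrightarrow> v = n + i" for u v i j
  proof -
    assume u: "u = mid i j" and e: "(u, v) \<in> E" and j: "j < n"
    from E_cases[OF e] show "v = n + i"
    proof (elim disjE exE conjE)
      fix i' j' assume "(i', j') \<in> S" "u = j'"
      then show ?thesis using S_D(2)[of i' j'] u mid_ge[of i j] by linarith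
    next
      fix i' j' assume a: "(i', j') \<in> S" "u = mid i' j'" "v = n + i'"
      then show ?thesis using mid_inj[of i j i' j'] S_D(2)[OF a(1)] u j by simp
    qed
  qed
  have no_out: "(n + i, v) \<notin> E" if "i < m" for i v
  proof
    assume "(n + i, v) \<in> E"
    from E_cases[OF this] show False
    proof (elim disjE exE conjE)
      fix i' j' assume "(i', j') \<in> S" "n + i = j'"
      then show False using S_D(2)[of i' j'] by linarith
    next
      fix i' j' assume "n + i = mid i' j'"
      then show False using mid_ge[of i' j'] that by linarith
    qed
  qed
  have len3: "length p \<le> 3 \<and> (length p = 3 \<longrightarrow> (\<exists>i j. (i, j) \<in> S \<and> p = [j, mid i j, n + i]))"
    if p: "successively (\<lambda>u v. (u, v) \<in> E) p" "length p \<ge> 3" for p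
  proof -
    obtain a b c r where [simp]: "p = a # b # c # r"
      using p(2) by (auto simp: numeral_3_eq_3 Suc_le_length_iff)
    have e: "(a, b) \<in> E" "(b, c) \<in> E" using p(1) by auto
    from E_cases[OF e(1)] obtain i j where ij: "(i, j) \<in> S" "a = j" "b = mid i j"
    proof (elim disjE exE conjE)
      fix i' j' assume "(i', j') \<in> S" "b = n + i'"
      then show ?thesis using no_out[of i' c] S_D(1)[of i' j'] e(2) by simp
    qed blast
    have c: "c = n + i" using out_mid[OF ij(3) e(2)] S_D(2)[OF ij(1)] by blast
    have "r = []"
      using p(1) c no_out S_D(1)[OF ij(1)] by (cases r) auto
    then show ?thesis using ij c by auto
  qed
  have path3: "is_path E [j, mid i j, n + i]" if "(i, j) \<in> S" for i j
    using that by (force simp: is_path_def E_def)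
  have depth: "has_depth N 2"
    unfolding has_depth_def
  proof (intro allI impI)
    fix p assume mx: "is_maximal_path (edges N) p"
    then have p: "is_path E p" by (simp add: N_def is_maximal_path_def)
    show "length p = 2 + 1"
    proof (cases "length p \<ge> 3")
      case True
      then show ?thesis using len3 p by (force simp: is_path_def)
    next
      case False
      then have "length p = 2" using p by (simp add: is_path_def)
      then obtain a b where ab: "p = [a, b]"
        by (auto simp: numeral_2_eq_2 length_Suc_conv)
      then have "(a, b) \<in> E" using p by (simp add: is_path_def)
      then obtain i j where ij: "(i, j) \<in> S" "a = j \<and> b = mid i j \<or> a = mid i j \<and> b = n + i"
        using E_cases by blast
      have "sublist p [j, mid i j, n + i]"
        using ij(2)
      proof
        assume "a = j \<and> b = mid i j"
        then have "[j, mid i j, n + i] = [] @ p @ [n + i]" by (simp add: ab)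
        then show ?thesis by (metis sublist_appendI)
      next
        assume "a = mid i j \<and> b = n + i"
        then have "[j, mid i j, n + i] = [j] @ p @ []" by (simp add: ab)
        then show ?thesis by (metis sublist_appendI)
      qed
      then have "[j, mid i j, n + i] = p"
        using mx path3[OF ij(1)] by (simp add: is_maximal_path_def N_def)
      then show ?thesis by auto
    qed
  qed
  have acyc: "acyclic E"
  proof -
    define f :: "nat \<Rightarrow> nat" where "f = (\<lambda>v. if v < n then 0 else if v < m + n then 2 else 1)"
    have "f (mid i j) = 1" for i j using mid_ge[of i j] by (simp add: f_def)
    moreover have "f j = 0" "f (n + i) = 2" if "(i, j) \<in> S" for i j
      using S_D[OF that] by (simp_all add: f_def)
    ultimately have "E \<subseteq> measure f" by (auto simp: E_def)
    then show ?thesis using wf_acyclic[OF wf_measure] acyclic_subset by blast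
  qed
  have EV: "E \<subseteq> {..<m + n + m * n} \<times> {..<m + n + m * n}"
  proof -
    have "mid i j < m + n + m * n" "j < m + n + m * n" "n + i < m + n + m * n"
      if "(i, j) \<in> S" for i j
      using mid_lt[of i j] S_D[OF that] by linarith+
    then show ?thesis by (auto simp: E_def)
  qed
  have net: "is_network m n N"
    using acyc EV no_in no_out
    by (auto simp: is_network_def N_def is_source_def is_sink_def inj_on_def)
  have "A $$ (i, j) \<longleftrightarrow> (\<exists>p. is_path E p \<and> hd p = j \<and> last p = n + i)" if "i < m" "j < n" for i j
  proof
    assume "A $$ (i, j)"
    then have "(i, j) \<in> S" using that by (simp add: S_def)
    then show "\<exists>p. is_path E p \<and> hd p = j \<and> last p = n + i" using path3 by force
  next
    assume "\<exists>p. is_path E p \<and> hd p = j \<and> last p = n + i"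
    then obtain p where p: "is_path E p" "hd p = j" "last p = n + i" by blast
    show "A $$ (i, j)"
    proof (cases "length p \<ge> 3")
      case True
      then obtain i' j' where "(i', j') \<in> S" "p = [j', mid i' j', n + i']"
        using len3 p by (force simp: is_path_def)
      then show ?thesis using p S_D by simp
    next
      case False
      then have "length p = 2" using p by (simp add: is_path_def)
      then obtain a b where ab: "p = [a, b]"
        by (auto simp: numeral_2_eq_2 length_Suc_conv)
      then have "(j, n + i) \<in> E" using p by (simp add: is_path_def)
      from E_cases[OF this] show ?thesis
      proof (elim disjE exE conjE)
        fix i' j' assume "n + i = mid i' j'"
        then show ?thesis using mid_ge[of i' j'] that by linarith
      next
        fix i' j' assume "j = mid i' j'"
        then show ?thesis using mid_ge[of i' j'] that by linarith
      qed
    qed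
  qed
  then have "expresses N A" using net by (simp add: expresses_def N_def m_def n_def)
  with depth show ?thesis by blast
qed

lemma OR2_attained:
  "\<exists>N :: nat rectifier_network. expresses N A \<and> has_depth N 2 \<and> network_size N = OR2 A"
  unfolding OR2_def by (rule LeastI_ex) (use ex_depth2_network[of A] in blast)

end

theory Submission
  imports Defs "HOL-Library.Nat_Bijection" "HOL-Analysis.Convex"
begin

text \<open>A subset \<open>S\<close> of the \<open>k\<close>-element ground set gives the rectangle of all pairs \<open>(A, B)\<close> with
  \<open>A \<subseteq> S\<close>, \<open>B \<inter> S = {}\<close>, \<open>|A| = a\<close>, \<open>|B| = b\<close>. With \<open>|S| = s\<close> its sides are
  \<open>f = C(s, a)\<close> and \<open>g = C(k - s, b)\<close>, and a greedy choice of about \<open>N / (f g) * ln N\<close> sets \<open>S\<close>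
  covers all \<open>N = C(k, a) C(k - a, b)\<close> disjoint pairs of this type, at cost
  \<open>(N / f + N / g) * ln N\<close>. Taking \<open>s\<close> where \<open>f\<close> and \<open>g\<close> cross, these are equal up to a factor
  polynomial in \<open>k\<close>, so it suffices to bound \<open>N\<close> by \<open>(9/4)^k f^l g^(1-l)\<close>, up to such a
  factor, for some \<open>l\<close> in \<open>[0, 1]\<close>.

  Put \<open>p = a / s\<close> and \<open>q = b / (k - s)\<close>, and choose \<open>l\<close> such that
  \<open>z = (1 - p)^l = (1 - q)^(1-l)\<close>. The mode of the binomial distribution gives
  \<open>f \<ge> p^(-a) (1 - p)^(a-s) / (s + 1)\<close> and likewise for \<open>g\<close>; with \<open>P = p^l\<close> and \<open>Q = q^(1-l)\<close>
  the trinomial expansion gives \<open>N P^a Q^b z^(k-a-b) \<le> (P + Q + z)^k\<close>. Finally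
  \<open>P Q + z^2 \<le> 1\<close> by the weighted AM-GM inequality, which yields \<open>P + Q + z \<le> 9 / 4\<close>.\<close>

subsection \<open>Networks from rectangle covers\<close>

text \<open>Each rectangle becomes one middle vertex with an edge from every input in
  \<open>C x\<close> and an edge to every output in \<open>R x\<close>. An input then reaches an
  output exactly when some rectangle contains both.\<close>

lemma OR2_le_rectangle_cover:
  fixes R C :: "'i \<Rightarrow> nat set"
  assumes fin: "finite I"
    and sub: "\<And>x. x \<in> I \<Longrightarrow> R x \<subseteq> {..<dim_row A} \<and> C x \<subseteq> {..<dim_col A}"
    and cover: "\<And>i j. i < dim_row A \<Longrightarrow> j < dim_col A \<Longrightarrow>
      A $$ (i, j) \<longleftrightarrow> (\<exists>x \<in> I. i \<in> R x \<and> j \<in> C x)"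
  shows "OR2 A \<le> (\<Sum>x\<in>I. card (R x) + card (C x))"
proof -
  define m n where "m = dim_row A" and "n = dim_col A"
  \<comment> \<open>A rectangle with an empty side would yield maximal paths with a single edge.\<close>
  define J where "J = {x \<in> I. R x \<noteq> {} \<and> C x \<noteq> {}}"
  have finJ: "finite J" using fin by (simp add: J_def)
  obtain h where h: "inj_on h J" "h ` J = {..<card J}"
    using ex_bij_betw_finite_nat[OF finJ] by (auto simp: bij_betw_def atLeast0LessThan)
  \<comment> \<open>Vertices are numbered in three blocks: inputs below \<open>n\<close>, outputs
    from \<open>n\<close> to \<open>n + m - 1\<close>, middle vertices from \<open>n + m\<close>
    on.\<close>
  define mid where "mid x = n + m + h x" for x
  define E1 where "E1 = (\<Union>x\<in>J. (\<lambda>j. (j, mid x)) ` C x)"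
  define E2 where "E2 = (\<Union>x\<in>J. (\<lambda>i. (mid x, n + i)) ` R x)"
  define E where "E = E1 \<union> E2"
  define N where "N = \<lparr>verts = {..<n + m + card J}, edges = E, inp = (\<lambda>j. j), outp = (\<lambda>i. n + i)\<rparr>"
  have bounds: "j < n" if "x \<in> J" "j \<in> C x" for x j
    using that sub by (fastforce simp: J_def n_def)
  have bounds': "i < m" if "x \<in> J" "i \<in> R x" for x i
    using that sub by (fastforce simp: J_def m_def)
  have edge_cases: "(\<exists>x\<in>J. u \<in> C x \<and> v = mid x) \<or> (\<exists>x\<in>J. \<exists>i \<in> R x. u = mid x \<and> v = n + i)"
    if "(u, v) \<in> E" for u v
    using that by (auto simp: E_def E1_def E2_def)
  have mid_eq: "x = y" if "mid x = mid y" "x \<in> J" "y \<in> J" for x y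
    using that h(1) by (auto simp: mid_def inj_on_def)
  have mid_ge: "n + m \<le> mid x" for x by (simp add: mid_def)
  have edge_in: "u < n" "\<exists>x\<in>J. u \<in> C x \<and> v = mid x" if "(u, v) \<in> E" "u < n + m" for u v
  proof -
    show "\<exists>x\<in>J. u \<in> C x \<and> v = mid x"
      using edge_cases[OF that(1)] that(2) mid_ge by (metis not_le)
    then show "u < n" using bounds by blast
  qed
  have edge_out: "\<exists>i \<in> R x. v = n + i" if "(mid x, v) \<in> E" "x \<in> J" for x v
  proof -
    have "mid x \<notin> C y" if "y \<in> J" for y using bounds[OF that, of "mid x"] mid_ge[of x] by auto
    then show ?thesis using edge_cases[OF that(1)] that(2) mid_eq by metis
  qed
  have edge_tgt: "n \<le> v" if "(u, v) \<in> E" for u v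
    using edge_cases[OF that] mid_ge by (metis add_leE le_add1)
  have edge1: "(j, mid x) \<in> E" if "x \<in> J" "j \<in> C x" for x j
    using that by (auto simp: E_def E1_def)
  have edge2: "(mid x, n + i) \<in> E" if "x \<in> J" "i \<in> R x" for x i
    using that by (auto simp: E_def E2_def)
  have no_out: "(n + i, v) \<notin> E" if "i < m" for i v
    using edge_in(1)[of "n + i" v] that by auto
  have path3: "is_path E [j, mid x, n + i]" if "x \<in> J" "i \<in> R x" "j \<in> C x" for x i j
    using edge1 edge2 that by (simp add: is_path_def)
  \<comment> \<open>Outputs have no outgoing edge, so a path that reaches one after two edges ends
    there.\<close>
  have long_path: "\<exists>x\<in>J. \<exists>i \<in> R x. \<exists>j \<in> C x. p = [j, mid x, n + i]"
    if p: "is_path E p" "3 \<le> length p" for p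
  proof -
    obtain u v w r where puvw: "p = u # v # w # r"
      using p(2) by (auto simp: numeral_3_eq_3 Suc_le_length_iff)
    have e: "(u, v) \<in> E" "(v, w) \<in> E" using p(1) by (auto simp: is_path_def puvw)
    obtain x where x: "x \<in> J" "u \<in> C x" "v = mid x"
      using edge_cases[OF e(1)] e(2) no_out bounds' by metis
    obtain i where i: "i \<in> R x" "w = n + i" using edge_out e(2) x by blast
    have "r = []"
      using p(1) no_out[OF bounds'[OF x(1) i(1)]] i(2) by (cases r) (auto simp: is_path_def puvw)
    then show ?thesis using x i puvw by blast
  qed
  have short_path: "\<exists>u v. p = [u, v] \<and> (u, v) \<in> E" if p: "is_path E p" "\<not> 3 \<le> length p" for p
  proof -
    have "length p = 2" using p by (simp add: is_path_def)
    then obtain u v where "p = [u, v]" by (auto simp: numeral_2_eq_2 length_Suc_conv)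
    then show ?thesis using p by (simp add: is_path_def)
  qed
  have depth: "has_depth N 2"
    unfolding has_depth_def
  proof (intro allI impI)
    fix p assume mx: "is_maximal_path (edges N) p"
    then have p: "is_path E p" and ext: "\<And>q. is_path E q \<Longrightarrow> sublist p q \<Longrightarrow> q = p"
      by (auto simp: N_def is_maximal_path_def)
    show "length p = 2 + 1"
    proof (cases "3 \<le> length p")
      case True
      then show ?thesis using long_path[OF p] by auto
    next
      case False
      then obtain u v where uv: "p = [u, v]" "(u, v) \<in> E" using short_path[OF p] by blast
      from edge_cases[OF uv(2)] show ?thesis
      proof (elim disjE bexE conjE)
        fix x assume x: "x \<in> J" "u \<in> C x" "v = mid x"
        then obtain i where i: "i \<in> R x" by (auto simp: J_def)
        have "sublist p ([] @ p @ [n + i])" by (rule sublist_appendI)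
        then show ?thesis using ext[OF path3[OF x(1) i x(2)]] uv x by auto
      next
        fix x i assume x: "x \<in> J" "i \<in> R x" "u = mid x" "v = n + i"
        then obtain j where j: "j \<in> C x" by (auto simp: J_def)
        have "sublist p ([j] @ p @ [])" by (rule sublist_appendI)
        then show ?thesis using ext[OF path3[OF x(1,2) j]] uv x by auto
      qed
    qed
  qed
  have "acyclic E"
  proof -
    \<comment> \<open>Layer numbers: 0 for inputs, 1 for middle vertices, 2 for outputs. Every edge
      raises the layer, so there is no cycle.\<close>
    define f :: "nat \<Rightarrow> nat" where "f v = (if v < n then 0 else if v < n + m then 2 else 1)" for v
    have "(u, v) \<in> measure f" if "(u, v) \<in> E" for u v
      using edge_cases[OF that]
    proof (elim disjE bexE conjE)
      fix x assume "x \<in> J" "u \<in> C x" "v = mid x"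
      then show ?thesis using bounds[of x u] mid_ge[of x] by (auto simp: f_def)
    next
      fix x i assume "x \<in> J" "i \<in> R x" "u = mid x" "v = n + i"
      then show ?thesis using bounds'[of x i] mid_ge[of x] by (auto simp: f_def)
    qed
    then have "E \<subseteq> measure f" by auto
    then show ?thesis using wf_acyclic[OF wf_measure] acyclic_subset by blast
  qed
  moreover have "E \<subseteq> {..<n + m + card J} \<times> {..<n + m + card J}"
  proof -
    have "mid x < n + m + card J" if "x \<in> J" for x
      using h(2) that by (auto simp: mid_def)
    moreover have "j < n + m + card J" if "x \<in> J" "j \<in> C x" for x j
      using bounds[OF that] by simp
    moreover have "n + i < n + m + card J" if "x \<in> J" "i \<in> R x" for x i
      using bounds'[OF that] by simp
    ultimately show ?thesis by (auto simp: E_def E1_def E2_def)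
  qed
  ultimately have net: "is_network m n N"
    using edge_tgt no_out
    by (fastforce simp: is_network_def N_def is_source_def is_sink_def inj_on_def)
  have "A $$ (i, j) \<longleftrightarrow> (\<exists>p. is_path E p \<and> hd p = j \<and> last p = n + i)" if ij: "i < m" "j < n" for i j
  proof
    assume "A $$ (i, j)"
    then obtain x where "x \<in> J" "i \<in> R x" "j \<in> C x"
      using cover[of i j] ij by (auto simp: J_def m_def n_def)
    then show "\<exists>p. is_path E p \<and> hd p = j \<and> last p = n + i" using path3 by force
  next
    assume "\<exists>p. is_path E p \<and> hd p = j \<and> last p = n + i"
    then obtain p where p: "is_path E p" "hd p = j" "last p = n + i" by blast
    show "A $$ (i, j)"
    proof (cases "3 \<le> length p")
      case True
      then obtain x where "x \<in> J" "i \<in> R x" "j \<in> C x" using long_path[OF p(1)] p(2,3) by auto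
      then show ?thesis using cover[of i j] ij by (auto simp: J_def m_def n_def)
    next
      case False
      then have "(j, n + i) \<in> E" using short_path[OF p(1)] p(2,3) by auto
      then obtain x where "n + i = mid x" using edge_in(2)[of j "n + i"] ij by auto
      then show ?thesis using mid_ge[of x] ij by simp
    qed
  qed
  then have "expresses N A" using net by (simp add: expresses_def N_def m_def n_def)
  then have "OR2 A \<le> network_size N"
    unfolding OR2_def using depth by (intro Least_le) blast
  also have "\<dots> \<le> card E1 + card E2"
    by (simp add: network_size_def N_def E_def card_Un_le)
  also have "\<dots> \<le> (\<Sum>x\<in>J. card (C x)) + (\<Sum>x\<in>J. card (R x))"
  proof -
    have finC: "finite (C x)" "finite (R x)" if "x \<in> J" for x
      using bounds[OF that] bounds'[OF that] by (auto intro: finite_subset[of _ "{..<n}"] finite_subset[of _ "{..<m}"])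
    have "card E1 \<le> (\<Sum>x\<in>J. card (C x))"
      unfolding E1_def using finC
      by (intro order.trans[OF card_UN_le[OF finJ]] sum_mono card_image_le)
    moreover have "card E2 \<le> (\<Sum>x\<in>J. card (R x))"
      unfolding E2_def using finC
      by (intro order.trans[OF card_UN_le[OF finJ]] sum_mono card_image_le)
    ultimately show ?thesis by linarith
  qed
  also have "\<dots> = (\<Sum>x\<in>J. card (R x) + card (C x))" by (simp add: sum.distrib)
  also have "\<dots> \<le> (\<Sum>x\<in>I. card (R x) + card (C x))"
    using fin by (intro sum_mono2) (auto simp: J_def)
  finally show ?thesis .
qed

subsection \<open>Greedy covers\<close>

text \<open>The family grows by at most one set per round, and each round multiplies the bound on
  the uncovered points by \<open>1 - d / card F\<close>, which is nonnegative because
  \<open>d \<le> card F\<close>.\<close>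

lemma greedy_cover_step:
  fixes U :: "'u set" and F :: "'s set" and covers :: "'s \<Rightarrow> 'u \<Rightarrow> bool" and d :: nat
  assumes finU: "finite U" and finF: "finite F"
    and deg: "\<And>u. u \<in> U \<Longrightarrow> d \<le> card {S \<in> F. covers S u}"
    and d: "0 < d" "d \<le> card F"
  shows "\<exists>G\<subseteq>F. card G \<le> t \<and>
    real (card {u \<in> U. \<forall>S\<in>G. \<not> covers S u}) \<le> card U * (1 - d / card F) ^ t"
proof (induction t)
  case 0
  then show ?case by (intro exI[of _ "{}"]) auto
next
  case (Suc t)
  then obtain G where G: "G \<subseteq> F" "card G \<le> t"
    and le: "real (card {u \<in> U. \<forall>S\<in>G. \<not> covers S u}) \<le> card U * (1 - d / card F) ^ t" by blast
  define V where "V = {u \<in> U. \<forall>S\<in>G. \<not> covers S u}"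
  have finV: "finite V" using finU by (simp add: V_def)
  have F0: "0 < card F" "F \<noteq> {}" using d by auto
  \<comment> \<open>By double counting, some \<open>S\<close> covers at least the average share of the uncovered points.\<close>
  have "\<exists>S\<in>F. real d * card V / card F \<le> card {u \<in> V. covers S u}"
  proof (rule ccontr)
    assume "\<not> ?thesis"
    then have "(\<Sum>S\<in>F. real (card {u \<in> V. covers S u})) < (\<Sum>S\<in>F. real d * card V / card F)"
      using finF F0 by (intro sum_strict_mono) (auto simp: not_le)
    also have "\<dots> = (\<Sum>u\<in>V. real d)" using F0 by simp
    also have "\<dots> \<le> (\<Sum>u\<in>V. real (card {S \<in> F. covers S u}))"
      using deg by (intro sum_mono) (auto simp: V_def)
    also have "\<dots> = (\<Sum>S\<in>F. real (card {u \<in> V. covers S u}))"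
      using sum_multicount_gen[OF finF finV, of "\<lambda>S u. covers S u" "\<lambda>u. card {S \<in> F. covers S u}"]
      by (simp flip: of_nat_sum)
    finally show False by simp
  qed
  then obtain S where S: "S \<in> F" "real d * card V / card F \<le> card {u \<in> V. covers S u}" by blast
  have eq: "{u \<in> U. \<forall>S'\<in>insert S G. \<not> covers S' u} = V - {u \<in> V. covers S u}"
    by (auto simp: V_def)
  have "real (card {u \<in> U. \<forall>S'\<in>insert S G. \<not> covers S' u}) = card V - real (card {u \<in> V. covers S u})"
    unfolding eq using finV by (subst card_Diff_subset) (auto simp: of_nat_diff card_mono)
  also have "\<dots> \<le> card V * (1 - d / card F)" using S(2) by (simp add: algebra_simps)
  also have "\<dots> \<le> (card U * (1 - d / card F) ^ t) * (1 - d / card F)"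
    using le d F0 by (intro mult_right_mono) (auto simp: V_def)
  finally have "real (card {u \<in> U. \<forall>S'\<in>insert S G. \<not> covers S' u}) \<le> card U * (1 - d / card F) ^ Suc t"
    by (simp add: mult_ac)
  moreover have "card (insert S G) \<le> Suc t"
    using G(2) by (intro card_insert_le_m1) auto
  ultimately show ?case using S(1) G(1) by (intro exI[of _ "insert S G"]) auto
qed

text \<open>After more than \<open>card F / d * ln (card U)\<close> greedy rounds the bound on the
  number of uncovered points is below 1, so none is left.\<close>

lemma greedy_cover:
  fixes U :: "'u set" and F :: "'s set" and covers :: "'s \<Rightarrow> 'u \<Rightarrow> bool" and d :: nat
  assumes finU: "finite U" and finF: "finite F" and U: "U \<noteq> {}"
    and deg: "\<And>u. u \<in> U \<Longrightarrow> d \<le> card {S \<in> F. covers S u}" and d: "0 < d"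
  shows "\<exists>G\<subseteq>F. real (card G) \<le> card F / d * (ln (card U) + 1) \<and> (\<forall>u\<in>U. \<exists>S\<in>G. covers S u)"
proof -
  obtain u where "u \<in> U" using U by blast
  then have dF: "d \<le> card F"
    using deg[of u] card_mono[OF finF, of "{S \<in> F. covers S u}"] by auto
  define T where "T = real (card F) / d"
  have T: "1 \<le> T" using d dF by (simp add: T_def)
  have U1: "1 \<le> real (card U)" using U finU by (simp add: Suc_le_eq card_gt_0_iff)
  \<comment> \<open>The least natural number strictly above \<open>T * ln (card U)\<close>.
    Strictness brings the uncovered count below 1, and the surplus of at most 1 is absorbed because
    \<open>1 \<le> T\<close>.\<close>
  define t where "t = nat \<lfloor>T * ln (card U)\<rfloor> + 1"
  have "0 \<le> T * ln (card U)" using T U1 by simp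
  then have t: "T * ln (card U) < t" "real t \<le> T * ln (card U) + 1"
    unfolding t_def by linarith+
  obtain G where G: "G \<subseteq> F" "card G \<le> t"
    and le: "real (card {u \<in> U. \<forall>S\<in>G. \<not> covers S u}) \<le> card U * (1 - d / card F) ^ t"
    using greedy_cover_step[of U F d covers t, OF finU finF deg d dF] by auto
  have "(1 - d / card F) ^ t \<le> exp (- (1 / T)) ^ t"
    using exp_ge_add_one_self[of "- (1 / T)"] dF d by (intro power_mono) (auto simp: T_def)
  also have "\<dots> = exp (- (t / T))" by (subst exp_of_nat_mult[symmetric]) simp
  also have "\<dots> < exp (- ln (card U))" using t(1) T by (simp add: field_simps)
  also have "\<dots> = 1 / card U" using U1 by (simp add: exp_minus inverse_eq_divide)
  finally have "card U * (1 - d / card F) ^ t < 1" using U1 by (simp add: field_simps)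
  with le have "card {u \<in> U. \<forall>S\<in>G. \<not> covers S u} = 0" by linarith
  then have "\<forall>u\<in>U. \<exists>S\<in>G. covers S u" using finU by auto
  moreover have "real (card G) \<le> T * (ln (card U) + 1)"
    using G(2) t(2) T by (simp add: algebra_simps)
  ultimately show ?thesis using G(1) unfolding T_def by blast
qed

subsection \<open>Balanced sides\<close>

text \<open>The quotient of consecutive terms of \<open>a ^ i / fact i\<close> is
  \<open>a / (i + 1)\<close>, so the sequence does not decrease up to \<open>i = a\<close> and does
  not increase afterwards.\<close>

lemma fact_mult_power_le: "fact a * a ^ i \<le> fact i * (a ^ a :: nat)"
proof (cases "i \<le> a")
  case True
  then show ?thesis
  proof (induction rule: inc_induct)
    case (step i)
    have "a * (fact a * a ^ i) \<le> Suc i * (fact i * a ^ a)" using step.IH by (simp add: algebra_simps)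
    also have "\<dots> \<le> a * (fact i * a ^ a)" using step.hyps by (intro mult_right_mono) auto
    finally show ?case using step.hyps by (subst (asm) mult_le_cancel1) auto
  qed simp
next
  case False
  then have "a \<le> i" by simp
  then show ?thesis
  proof (induction rule: dec_induct)
    case (step i)
    have "fact a * a ^ Suc i \<le> a * (fact i * a ^ a)" using step.IH by (simp add: algebra_simps)
    also have "\<dots> \<le> Suc i * (fact i * a ^ a)" using step.hyps by (intro mult_right_mono) auto
    finally show ?case by (simp add: algebra_simps)
  qed simp
qed

text \<open>After clearing factorials this is the product of two instances of
  \<open>fact_mult_power_le\<close>, one for \<open>a\<close>, \<open>i\<close> and one for
  \<open>s - a\<close>, \<open>s - i\<close>.\<close>

lemma binomial_term_le_mode:
  assumes "a \<le> s" "i \<le> s"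
  shows "(s choose i) * a ^ i * (s - a) ^ (s - i) \<le> (s choose a) * a ^ a * (s - a) ^ (s - a)"
proof -
  define K :: nat where "K = (fact i * fact (s - i)) * (fact a * fact (s - a))"
  have "K * ((s choose i) * a ^ i * (s - a) ^ (s - i))
      = (fact i * fact (s - i) * (s choose i)) * ((fact a * a ^ i) * (fact (s - a) * (s - a) ^ (s - i)))"
    by (simp add: K_def mult_ac)
  also have "\<dots> = fact s * ((fact a * a ^ i) * (fact (s - a) * (s - a) ^ (s - i)))"
    using assms by (simp add: binomial_fact_lemma)
  also have "\<dots> \<le> fact s * ((fact i * a ^ a) * (fact (s - i) * (s - a) ^ (s - a)))"
    by (intro mult_left_mono mult_mono fact_mult_power_le) auto
  also have "\<dots> = (fact a * fact (s - a) * (s choose a)) * ((fact i * a ^ a) * (fact (s - i) * (s - a) ^ (s - a)))"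
    using assms by (simp add: binomial_fact_lemma)
  also have "\<dots> = K * ((s choose a) * a ^ a * (s - a) ^ (s - a))"
    by (simp add: K_def mult_ac)
  finally show ?thesis by (subst (asm) mult_le_cancel1) (auto simp: K_def)
qed

text \<open>The expansion of \<open>(a + (s - a)) ^ s\<close> has \<open>s + 1\<close> terms, none
  larger than the one at \<open>a\<close>; dividing by \<open>s ^ s\<close> turns that term into the
  probability of the mode.\<close>

lemma binomial_mode_ge:
  assumes "0 < s" "a \<le> s"
  shows "1 \<le> (real s + 1) * (real (s choose a) * (a / s) ^ a * (1 - a / s) ^ (s - a))"
proof -
  have "s ^ s = (a + (s - a)) ^ s" using assms by simp
  also have "\<dots> = (\<Sum>i\<le>s. (s choose i) * a ^ i * (s - a) ^ (s - i))"
    by (subst binomial) simp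
  also have "\<dots> \<le> (\<Sum>i\<le>s. (s choose a) * a ^ a * (s - a) ^ (s - a))"
    using assms by (intro sum_mono binomial_term_le_mode) auto
  finally have "s ^ s \<le> (s + 1) * ((s choose a) * a ^ a * (s - a) ^ (s - a))" by simp
  then have "real (s ^ s) \<le> real ((s + 1) * ((s choose a) * a ^ a * (s - a) ^ (s - a)))"
    by (rule of_nat_mono)
  then have "real s ^ s \<le> (real s + 1) * (real (s choose a) * real a ^ a * (real s - a) ^ (s - a))"
    using assms by (simp add: of_nat_diff algebra_simps)
  moreover have "(a / s) ^ a * (1 - a / s) ^ (s - a) = real a ^ a * (real s - a) ^ (s - a) / real s ^ s"
  proof -
    have "1 - a / s = (real s - a) / s" using assms by (simp add: field_simps)
    moreover have "real s ^ s = real s ^ a * real s ^ (s - a)"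
      using assms by (simp flip: power_add)
    ultimately show ?thesis by (simp add: power_divide)
  qed
  ultimately have "real s ^ s \<le> (real s + 1) *
      (real (s choose a) * ((a / s) ^ a * (1 - a / s) ^ (s - a) * real s ^ s))"
    using assms by (simp add: mult.assoc)
  then have "1 * real s ^ s \<le> ((real s + 1) *
      (real (s choose a) * (a / s) ^ a * (1 - a / s) ^ (s - a))) * real s ^ s"
    by (simp add: mult_ac)
  then show ?thesis using assms by (subst (asm) mult_le_cancel_right_pos) auto
qed

section \<open>Trinomial coefficients and the constant 9/4\<close>

text \<open>The left side is a single term of the trinomial expansion, isolated by keeping one term
  of a binomial expansion twice.\<close>

lemma trinomial_le_power:
  fixes x y z :: real
  assumes "0 \<le> x" "0 \<le> y" "0 \<le> z" "a + b \<le> k"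
  shows "real (k choose a) * real (k - a choose b) * (x ^ a * y ^ b * z ^ (k - a - b)) \<le> (x + y + z) ^ k"
proof -
  have bin: "real (n choose i) * u ^ i * v ^ (n - i) \<le> (u + v) ^ n"
    if "i \<le> n" "0 \<le> u" "0 \<le> v" for n i and u v :: real
    unfolding binomial_ring using that by (intro member_le_sum) auto
  have "real (k choose a) * x ^ a * (real (k - a choose b) * y ^ b * z ^ (k - a - b))
      \<le> real (k choose a) * x ^ a * (y + z) ^ (k - a)"
    using assms by (intro mult_left_mono bin) auto
  also have "\<dots> \<le> (x + (y + z)) ^ k"
    using assms by (intro bin) auto
  finally show ?thesis by (simp add: mult_ac add_ac)
qed

lemma sum_le_nine_fourths:
  fixes p q l m :: real
  assumes p: "0 < p" "p < 1" and q: "0 < q" "q < 1" and l: "0 \<le> l" "0 \<le> m" "l + m = 1"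
    and eq: "(1 - p) powr l = (1 - q) powr m"
  shows "p powr l + q powr m + (1 - p) powr l \<le> 9 / 4"
proof -
  define P Q z where "P = p powr l" and "Q = q powr m" and "z = (1 - p) powr l"
  \<comment> \<open>Both powers in \<open>eq\<close> have the value \<open>z\<close>, so
    \<open>z * z\<close> is \<open>(1 - p) powr l * (1 - q) powr m\<close>, and Young's inequality
    applies to it with the same weights as to \<open>P * Q\<close>.\<close>
  have "P * Q + z * z \<le> (l * p + m * q) + (l * (1 - p) + m * (1 - q))"
    unfolding P_def Q_def z_def using assms
    by (intro add_mono) (use Youngs_inequality_0[of l m p q] Youngs_inequality_0[of l m "1 - p" "1 - q"] in auto)
  also have "\<dots> = 1" using l(3) by (simp add: algebra_simps)
  finally have "P * Q + z * z \<le> 1" .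
  \<comment> \<open>hence \<open>P + Q \<le> 1 + P * Q \<le> 2 - z\<^sup>2\<close>, and \<open>2 + z - z\<^sup>2\<close> is maximal at \<open>z = 1 / 2\<close>\<close>
  moreover have "0 \<le> (1 - P) * (1 - Q)"
    unfolding P_def Q_def using p q l by (intro mult_nonneg_nonneg) (auto simp: powr_le1)
  moreover have "0 \<le> (z - 1 / 2)\<^sup>2" by simp
  ultimately have "P + Q + z \<le> 9 / 4" by (simp add: algebra_simps power2_eq_square)
  then show ?thesis by (simp add: P_def Q_def z_def)
qed

text \<open>Both sides are the trinomial coefficient
  \<open>fact k / (fact a * fact b * fact (k - a - b))\<close>.\<close>

lemma choose_mult_commute:
  assumes "a + b \<le> k"
  shows "(k choose a) * (k - a choose b) = (k choose b) * (k - b choose a)"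
proof -
  have *: "fact k = fact i * fact j * fact (k - i - j) * ((k choose i) * (k - i choose j))"
    if "i + j \<le> k" for i j
  proof -
    have "fact k = fact i * fact (k - i) * (k choose i)"
      using that by (intro binomial_fact_lemma[symmetric]) simp
    also have "fact (k - i) = fact j * fact (k - i - j) * (k - i choose j)"
      using that by (intro binomial_fact_lemma[symmetric]) simp
    finally show ?thesis by (simp only: mult_ac)
  qed
  have "fact a * fact b * fact (k - a - b) * ((k choose a) * (k - a choose b))
      = fact b * fact a * fact (k - b - a) * ((k choose b) * (k - b choose a))"
    using *[of a b] *[of b a] assms by (metis add.commute)
  also have "\<dots> = fact a * fact b * fact (k - a - b) * ((k choose b) * (k - b choose a))"
    by (simp only: mult_ac diff_commute)
  finally show ?thesis by simp
qed

text \<open>The strict inequalities keep \<open>p\<close> and \<open>q\<close> strictly between 0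
  and 1, so both logarithms are negative and the weights are well defined. The mode bounds for
  \<open>f\<close> and \<open>g\<close>, raised to the weights and multiplied, contain the very
  monomial \<open>mon\<close> that the trinomial bound controls.\<close>

lemma trinomial_le_interpolation_interior:
  fixes a b s t :: nat
  assumes "0 < a" "a < s" "0 < b" "b < t"
  obtains l :: real where "0 \<le> l" "l \<le> 1"
    "real (s + t choose a) * real (s + t - a choose b)
       \<le> (real s + 1) * (real t + 1) * (9 / 4) ^ (s + t)
          * (real (s choose a) powr l * real (t choose b) powr (1 - l))"
proof -
  define p q where "p = real a / s" and "q = real b / t"
  have p: "0 < p" "p < 1" and q: "0 < q" "q < 1" using assms by (auto simp: p_def q_def)
  define lp lq where "lp = ln (1 - p)" and "lq = ln (1 - q)"
  have neg: "lp < 0" "lq < 0" using p q by (auto simp: lp_def lq_def)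
  \<comment> \<open>The solution of \<open>l * lp = m * lq\<close> with \<open>l + m = 1\<close>,
    that is, of \<open>eq\<close> after taking logarithms.\<close>
  define l m where "l = lq / (lp + lq)" and "m = lp / (lp + lq)"
  have lm: "0 \<le> l" "0 \<le> m" "l + m = 1" using neg
    by (auto simp: l_def m_def divide_nonpos_neg add_neg_neg add_divide_distrib[symmetric])
  have eq: "(1 - p) powr l = (1 - q) powr m"
    using p q by (simp add: powr_def l_def m_def lp_def lq_def mult.commute)
  define P Q z where "P = p powr l" and "Q = q powr m" and "z = (1 - p) powr l"
  define N f g where "N = real (s + t choose a) * real (s + t - a choose b)"
    and "f = real (s choose a)" and "g = real (t choose b)"
  define mon where "mon = P ^ a * Q ^ b * z ^ (s + t - a - b)"
  have fg: "0 < f" "0 < g" using assms by (auto simp: f_def g_def)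
  have W: "P + Q + z \<le> 9 / 4"
    unfolding P_def Q_def z_def using p q lm eq by (rule sum_le_nine_fourths)
  have Nmon: "N * mon \<le> (9 / 4) ^ (s + t)"
  proof -
    have "N * mon \<le> (P + Q + z) ^ (s + t)"
      unfolding N_def mon_def using assms
      by (intro trinomial_le_power) (auto simp: P_def Q_def z_def)
    also have "\<dots> \<le> (9 / 4) ^ (s + t)"
      using W by (intro power_mono) (auto simp: P_def Q_def z_def)
    finally show ?thesis .
  qed
  \<comment> \<open>This is \<open>binomial_mode_ge\<close> raised to the power \<open>e\<close>: a
    number at least 1 stays so for \<open>0 \<le> e\<close>, and
    \<open>(real n + 1) powr e \<le> real n + 1\<close> for \<open>e \<le> 1\<close>.\<close>
  have bin: "1 \<le> (real n + 1) * (real (n choose i) powr e * (r powr e) ^ i * ((1 - r) powr e) ^ (n - i))"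
    if "0 < i" "i < n" "r = real i / n" "0 \<le> e" "e \<le> 1" for n i and r e :: real
  proof -
    have r: "0 < r" "r < 1" using that by auto
    have "1 \<le> (real n + 1) * (real (n choose i) * r ^ i * (1 - r) ^ (n - i))"
      using binomial_mode_ge[of n i] that by simp
    then have "1 \<le> ((real n + 1) * (real (n choose i) * r ^ i * (1 - r) ^ (n - i))) powr e"
      using that by (simp add: ge_one_powr_ge_zero)
    also have "\<dots> = (real n + 1) powr e * (real (n choose i) powr e * (r powr e) ^ i * ((1 - r) powr e) ^ (n - i))"
      using r by (simp add: powr_mult powr_powr mult_ac flip: powr_realpow)
    also have "\<dots> \<le> (real n + 1) * (real (n choose i) powr e * (r powr e) ^ i * ((1 - r) powr e) ^ (n - i))"
      using that r powr_mono[of e 1 "real n + 1"] by (intro mult_right_mono) auto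
    finally show ?thesis .
  qed
  have "1 * 1 \<le> ((real s + 1) * (f powr l * P ^ a * z ^ (s - a))) * ((real t + 1) * (g powr m * Q ^ b * z ^ (t - b)))"
    using bin[of a s p l] bin[of b t q m] assms lm unfolding f_def g_def P_def Q_def
    by (intro mult_mono) (auto simp: p_def q_def z_def eq[unfolded p_def q_def])
  also have "\<dots> = (real s + 1) * (real t + 1) * (f powr l * g powr m) * mon"
  proof -
    \<comment> \<open>The choice of weights pays off here: the exponents \<open>s - a\<close> and
      \<open>t - b\<close> fall on the same base \<open>z\<close>.\<close>
    have "z ^ (s + t - a - b) = z ^ (s - a) * z ^ (t - b)"
      using assms by (simp flip: power_add)
    then show ?thesis by (simp add: mon_def mult_ac)
  qed
  finally have one: "1 \<le> (real s + 1) * (real t + 1) * (f powr l * g powr m) * mon" by simp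
  have "N * 1 \<le> N * ((real s + 1) * (real t + 1) * (f powr l * g powr m) * mon)"
    using one by (intro mult_left_mono) (auto simp: N_def)
  also have "\<dots> = (real s + 1) * (real t + 1) * (f powr l * g powr m) * (N * mon)"
    by (simp add: mult_ac)
  also have "\<dots> \<le> (real s + 1) * (real t + 1) * (f powr l * g powr m) * (9 / 4) ^ (s + t)"
    using Nmon by (intro mult_left_mono) auto
  finally have "N \<le> (real s + 1) * (real t + 1) * (9 / 4) ^ (s + t) * (f powr l * g powr m)"
    by (simp add: mult_ac)
  moreover have "m = 1 - l" using lm by simp
  ultimately show ?thesis using that[of l] lm unfolding N_def f_def g_def by simp
qed

text \<open>On the boundary \<open>l = 0\<close> or \<open>l = 1\<close> suffices: the left side is
  then one binomial coefficient, at most \<open>2 ^ (s + t)\<close>, times \<open>s choose a\<close>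
  or \<open>t choose b\<close>.\<close>

lemma trinomial_le_interpolation:
  fixes a b s t :: nat
  assumes "a \<le> s" "b \<le> t"
  obtains l :: real where "0 \<le> l" "l \<le> 1"
    "real (s + t choose a) * real (s + t - a choose b)
       \<le> (real s + 1) * (real t + 1) * (9 / 4) ^ (s + t)
          * (real (s choose a) powr l * real (t choose b) powr (1 - l))"
proof -
  have le: "real (s + t choose i) * x \<le> (real s + 1) * (real t + 1) * (9 / 4) ^ (s + t) * x"
    if "0 \<le> x" for i and x :: real
  proof (rule mult_right_mono)
    have "real (s + t choose i) \<le> 2 ^ (s + t)"
      using binomial_le_pow2[of "s + t" i] by (metis of_nat_le_iff of_nat_numeral of_nat_power)
    also have "\<dots> \<le> 1 * (9 / 4) ^ (s + t)" by (simp add: power_mono)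
    also have "\<dots> \<le> (real s + 1) * (real t + 1) * (9 / 4) ^ (s + t)"
      by (intro mult_right_mono) (auto simp: algebra_simps)
    finally show "real (s + t choose i) \<le> (real s + 1) * (real t + 1) * (9 / 4) ^ (s + t)" .
  qed fact
  have pos: "0 < s choose a" "0 < t choose b" using assms by auto
  consider "a = 0" | "b = 0" | "a = s" | "b = t" | "0 < a" "a < s" "0 < b" "b < t"
    using assms by linarith
  then show ?thesis
  proof cases
    case 1
    then show ?thesis using that[of 1] le[of 1 b] pos by simp
  next
    case 2
    then show ?thesis using that[of 0] le[of 1 a] pos by simp
  next
    case 3
    then show ?thesis using that[of 0] le[of "real (t choose b)" a] pos by simp
  next
    case 4
    \<comment> \<open>Choosing the \<open>b\<close>-set first exposes \<open>s choose a\<close>,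
      since \<open>s + t - b = s\<close>.\<close>
    have "real (s + t choose a) * real (s + t - a choose b) = real (s + t choose b) * real (s choose a)"
      using 4 assms choose_mult_commute[of a b "s + t"] by (simp flip: of_nat_mult)
    then show ?thesis using that[of 1] le[of "real (s choose a)" b] pos 4 by simp
  next
    case 5
    then show ?thesis using that by (rule trinomial_le_interpolation_interior)
  qed
qed

section \<open>Splitting \<open>k\<close> where the two sides cross\<close>

lemma choose_Suc_le:
  assumes "b \<le> m"
  shows "(Suc m choose b) \<le> Suc m * (m choose b)"
proof -
  have "1 * (Suc m choose b) \<le> (Suc m - b) * (Suc m choose b)"
    using assms by (intro mult_right_mono) auto
  also have "\<dots> = Suc m * (m choose b)" using binomial_absorb_comp[of "Suc m" b] by simp
  finally show ?thesis by simp
qed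

text \<open>Take the largest \<open>s\<close> with \<open>s choose a \<le> k - s choose b\<close>.
  One more step reverses the comparison, and a step changes each side by a factor of at most
  \<open>k + 1\<close>.\<close>

lemma balanced_split:
  fixes a b k :: nat
  assumes "a + b \<le> k"
  obtains s t where "s + t = k" "a \<le> s" "b \<le> t" "s choose a \<le> t choose b"
    "t choose b \<le> (k + 1)\<^sup>2 * (s choose a)"
proof -
  define X where "X = {s. a \<le> s \<and> s + b \<le> k \<and> s choose a \<le> k - s choose b}"
  have fin: "finite X" by (rule finite_subset[of _ "{..k}"]) (auto simp: X_def)
  have "a \<in> X" using assms by (auto simp: X_def Suc_le_eq)
  define s where "s = Max X"
  have sX: "s \<in> X" using fin \<open>a \<in> X\<close> unfolding s_def by (intro Max_in) auto
  then have s: "a \<le> s" "s + b \<le> k" "s choose a \<le> k - s choose b" by (auto simp: X_def)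
  have "k - s choose b \<le> (k + 1)\<^sup>2 * (s choose a)"
  proof (cases "s + b = k")
    \<comment> \<open>No further step is possible, but here \<open>k - s choose b\<close> is
      \<open>b choose b\<close>, which is 1.\<close>
    case True
    have "1 * 1 \<le> (k + 1)\<^sup>2 * (s choose a)" using s by (intro mult_le_mono) (auto simp: Suc_le_eq)
    then show ?thesis using True by auto
  next
    case False
    have "Suc s \<notin> X" using Max_ge[OF fin, of "Suc s"] by (auto simp flip: s_def)
    then have less: "k - Suc s choose b < Suc s choose a" using s False by (auto simp: X_def)
    have Suc: "k - s = Suc (k - Suc s)" using s False by simp
    have "k - s choose b \<le> (k + 1) * (k - Suc s choose b)"
    proof -
      have "Suc (k - Suc s) choose b \<le> Suc (k - Suc s) * (k - Suc s choose b)"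
        using s False by (intro choose_Suc_le) auto
      also have "\<dots> \<le> (k + 1) * (k - Suc s choose b)" by (intro mult_right_mono) auto
      finally show ?thesis by (simp only: Suc)
    qed
    also have "\<dots> \<le> (k + 1) * (Suc s choose a)" using less by (intro mult_left_mono) auto
    also have "\<dots> \<le> (k + 1) * (Suc s * (s choose a))"
      using s by (intro mult_left_mono choose_Suc_le) auto
    also have "\<dots> \<le> (k + 1) * ((k + 1) * (s choose a))"
      using s by (intro mult_left_mono mult_right_mono) auto
    finally show ?thesis by (simp add: power2_eq_square algebra_simps)
  qed
  then show ?thesis using that[of s "k - s"] s by auto
qed

text \<open>As \<open>f \<le> g \<le> (k + 1)^2 * f\<close>, the mean
  \<open>f powr l * g powr (1 - l)\<close> is at most \<open>(k + 1)^2 * f\<close> whatever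
  \<open>l\<close> the interpolation supplies. The fourth power joins this factor with
  \<open>(s + 1) * (t + 1)\<close>.\<close>

lemma balanced_split_cost:
  fixes a b k :: nat
  assumes "a + b \<le> k"
  obtains s t where "s + t = k" "a \<le> s" "b \<le> t"
    "real (k choose a) * real (k - a choose b) * (1 / real (s choose a) + 1 / real (t choose b))
       \<le> 2 * (real k + 1) ^ 4 * (9 / 4) ^ k"
proof -
  obtain s t where st: "s + t = k" "a \<le> s" "b \<le> t" and bal: "s choose a \<le> t choose b"
    "t choose b \<le> (k + 1)\<^sup>2 * (s choose a)"
    using balanced_split[OF assms] by blast
  define N f g where "N = real (k choose a) * real (k - a choose b)"
    and "f = real (s choose a)" and "g = real (t choose b)"
  have f1: "0 < f" using st by (auto simp: f_def)
  have fg: "f \<le> g" using bal by (simp add: f_def g_def)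
  have "real (t choose b) \<le> real ((k + 1)\<^sup>2 * (s choose a))" using bal(2) by (rule of_nat_mono)
  then have gf: "g \<le> (real k + 1)\<^sup>2 * f" by (simp add: f_def g_def add.commute)
  obtain l :: real where l: "0 \<le> l" "l \<le> 1"
    and N_le: "N \<le> (real s + 1) * (real t + 1) * (9 / 4) ^ k * (f powr l * g powr (1 - l))"
    using trinomial_le_interpolation[OF st(2,3)] unfolding N_def f_def g_def st(1) by blast
  note N_le
  also have "\<dots> \<le> (real k + 1) * (real k + 1) * (9 / 4) ^ k * ((real k + 1)\<^sup>2 * f)"
  proof (rule mult_mono)
    show "(real s + 1) * (real t + 1) * (9 / 4) ^ k \<le> (real k + 1) * (real k + 1) * (9 / 4 :: real) ^ k"
      using st by (intro mult_mono) auto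
    have "f powr l * g powr (1 - l) \<le> f powr l * ((real k + 1)\<^sup>2 * f) powr (1 - l)"
      using f1 fg gf l by (intro mult_left_mono powr_mono2) auto
    also have "\<dots> = ((real k + 1)\<^sup>2) powr (1 - l) * f"
      using f1 l by (simp add: powr_mult powr_add[symmetric] mult.left_commute)
    also have "\<dots> \<le> (real k + 1)\<^sup>2 * f"
      using f1 l powr_mono[of "1 - l" 1 "(real k + 1)\<^sup>2"] by (intro mult_right_mono) auto
    finally show "f powr l * g powr (1 - l) \<le> (real k + 1)\<^sup>2 * f" .
  qed auto
  finally have "N \<le> (real k + 1) ^ 4 * (9 / 4) ^ k * f"
    by (simp add: power2_eq_square power4_eq_xxxx mult_ac)
  then have Nf: "N / f \<le> (real k + 1) ^ 4 * (9 / 4) ^ k" using f1 by (simp add: field_simps)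
  moreover have "N / g \<le> N / f" using f1 fg by (intro divide_left_mono) (auto simp: N_def)
  ultimately have "N * (1 / f + 1 / g) \<le> 2 * (real k + 1) ^ 4 * (9 / 4) ^ k"
    by (simp add: algebra_simps)
  then show ?thesis using that st unfolding N_def f_def g_def by blast
qed

subsection \<open>Covers of the disjointness matrix\<close>

text \<open>Removing \<open>A\<close> from \<open>S\<close> leaves an arbitrary subset of
  \<open>K - A - B\<close> of size \<open>s - card A\<close>. The count depends on sizes only, so it
  serves as the degree \<open>d\<close> in the greedy cover.\<close>

lemma card_separating_sets:
  assumes "finite K" "A \<subseteq> K" "B \<subseteq> K" "A \<inter> B = {}" "card A \<le> s"
  shows "card {S. S \<subseteq> K \<and> card S = s \<and> A \<subseteq> S \<and> B \<subseteq> K - S}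
    = (card K - card A - card B choose (s - card A))"
proof -
  have fin: "finite A" "finite B" using assms finite_subset by blast+
  have "bij_betw (\<lambda>S. S - A) {S. S \<subseteq> K \<and> card S = s \<and> A \<subseteq> S \<and> B \<subseteq> K - S}
      {S. S \<subseteq> K - A - B \<and> card S = s - card A}"
  proof (rule bij_betw_byWitness[where f' = "\<lambda>S. S \<union> A"])
    show "(\<lambda>S. S - A) ` {S. S \<subseteq> K \<and> card S = s \<and> A \<subseteq> S \<and> B \<subseteq> K - S}
        \<subseteq> {S. S \<subseteq> K - A - B \<and> card S = s - card A}"
      using fin by (auto simp: card_Diff_subset)
    have "card (S \<union> A) = s" if "S \<subseteq> K - A - B" "card S = s - card A" for S
    proof -
      have "finite S" using that(1) assms(1) finite_subset by blast
      then show ?thesis using that fin assms(5) by (subst card_Un_disjoint) auto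
    qed
    moreover have "S \<union> A \<subseteq> K \<and> A \<subseteq> S \<union> A \<and> B \<subseteq> K - (S \<union> A)" if "S \<subseteq> K - A - B" for S
      using assms(2-4) that by blast
    ultimately show "(\<lambda>S. S \<union> A) ` {S. S \<subseteq> K - A - B \<and> card S = s - card A}
        \<subseteq> {S. S \<subseteq> K \<and> card S = s \<and> A \<subseteq> S \<and> B \<subseteq> K - S}"
      using assms(2) by (intro image_subsetI) simp
  qed auto
  then have "card {S. S \<subseteq> K \<and> card S = s \<and> A \<subseteq> S \<and> B \<subseteq> K - S}
      = card {S. S \<subseteq> K - A - B \<and> card S = s - card A}"
    by (rule bij_betw_same_card)
  also have "\<dots> = (card (K - A - B) choose (s - card A))"
    using assms(1) by (intro n_subsets) auto
  also have "card (K - A - B) = card K - card A - card B"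
    using assms fin by (subst card_Diff_subset; auto simp: card_Diff_subset)
  finally show ?thesis .
qed

lemma card_disjoint_pairs:
  assumes "finite K"
  shows "card {(A, B). A \<subseteq> K \<and> B \<subseteq> K \<and> A \<inter> B = {} \<and> card A = a \<and> card B = b}
    = (card K choose a) * (card K - a choose b)"
proof -
  have "{(A, B). A \<subseteq> K \<and> B \<subseteq> K \<and> A \<inter> B = {} \<and> card A = a \<and> card B = b}
      = Sigma {A. A \<subseteq> K \<and> card A = a} (\<lambda>A. {B. B \<subseteq> K - A \<and> card B = b})" by auto
  also have "card \<dots> = (\<Sum>A | A \<subseteq> K \<and> card A = a. card {B. B \<subseteq> K - A \<and> card B = b})"
    using assms by (intro card_SigmaI) auto
  also have "\<dots> = (\<Sum>A | A \<subseteq> K \<and> card A = a. card K - a choose b)"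
  proof (intro sum.cong refl)
    fix A assume "A \<in> {A. A \<subseteq> K \<and> card A = a}"
    then have "card (K - A) = card K - a"
      using assms finite_subset by (subst card_Diff_subset) auto
    then show "card {B. B \<subseteq> K - A \<and> card B = b} = (card K - a choose b)"
      using assms n_subsets[of "K - A" b] by simp
  qed
  also have "\<dots> = (card K choose a) * (card K - a choose b)"
    using assms by (simp add: n_subsets)
  finally show ?thesis .
qed

text \<open>Double counting of triples \<open>(A, B, S)\<close> with \<open>A\<close> inside and
  \<open>B\<close> outside \<open>S\<close>: choose \<open>S\<close> first, or \<open>A\<close> and
  \<open>B\<close> first. It turns the greedy ratio \<open>card F / d\<close> into
  \<open>card U / (f * g)\<close>.\<close>

lemma choose_mult_separating:
  assumes "a \<le> s" "b \<le> t"
  shows "(s + t choose s) * ((s choose a) * (t choose b))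
    = (s + t choose a) * (s + t - a choose b) * (s + t - a - b choose (s - a))"
proof -
  have "(s + t choose s) * (s choose a) = (s + t choose a) * (s + t - a choose (s - a))"
    using assms by (intro choose_mult) auto
  moreover have "(s + t - a choose (s - a)) * (t choose b)
      = (s + t - a choose b) * (s + t - a - b choose (s - a))"
    using choose_mult_commute[of "s - a" b "s + t - a"] assms by simp
  ultimately show ?thesis by (metis mult.assoc)
qed

text \<open>The greedy cover is applied to the disjoint pairs of sizes \<open>a\<close>,
  \<open>b\<close>, with the \<open>s\<close>-subsets of \<open>K\<close> as covering sets. Up to a
  logarithm its cost is \<open>card F / d * (f + g) = card U * (1 / f + 1 / g)\<close>, which the
  balanced split bounds.\<close>

lemma separating_family:
  fixes K :: "'a set" and a b :: nat
  assumes K: "finite K" and ab: "a + b \<le> card K"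
  shows "\<exists>G\<subseteq>Pow K.
    (\<forall>A B. A \<subseteq> K \<and> B \<subseteq> K \<and> A \<inter> B = {} \<and> card A = a \<and> card B = b
       \<longrightarrow> (\<exists>S\<in>G. A \<subseteq> S \<and> B \<subseteq> K - S)) \<and>
    (\<Sum>S\<in>G. real (card S choose a) + real (card (K - S) choose b))
       \<le> 4 * (real (card K) + 1) ^ 5 * (9 / 4) ^ card K"
proof -
  define k where "k = card K"
  obtain s t where st: "s + t = k" "a \<le> s" "b \<le> t" and
    cost: "real (k choose a) * real (k - a choose b) * (1 / real (s choose a) + 1 / real (t choose b))
       \<le> 2 * (real k + 1) ^ 4 * (9 / 4) ^ k"
    using balanced_split_cost[of a b k] ab by (auto simp: k_def)
  define U where "U = {(A, B). A \<subseteq> K \<and> B \<subseteq> K \<and> A \<inter> B = {} \<and> card A = a \<and> card B = b}"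
  define F where "F = {S. S \<subseteq> K \<and> card S = s}"
  define covers where "covers = (\<lambda>S (A, B). A \<subseteq> S \<and> B \<subseteq> K - S)"
  define d where "d = (k - a - b choose (s - a))"
  define f g where "f = real (s choose a)" and "g = real (t choose b)"
  have fg: "0 < f" "0 < g" using st by (auto simp: f_def g_def)
  have finU: "finite U"
    by (rule finite_subset[of _ "Pow K \<times> Pow K"]) (use K in \<open>auto simp: U_def\<close>)
  have finF: "finite F" using K by (simp add: F_def)
  have cardU: "card U = (k choose a) * (k - a choose b)"
    unfolding U_def k_def by (rule card_disjoint_pairs[OF K])
  have cardF: "card F = (k choose s)" unfolding F_def k_def by (rule n_subsets[OF K])
  have U0: "0 < card U" using ab by (simp add: cardU flip: k_def)
  have d0: "0 < d" using st by (auto simp: d_def)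
  have deg: "d \<le> card {S \<in> F. covers S u}" if "u \<in> U" for u
  proof -
    obtain A B where u: "u = (A, B)" by fastforce
    have "{S \<in> F. covers S u} = {S. S \<subseteq> K \<and> card S = s \<and> A \<subseteq> S \<and> B \<subseteq> K - S}"
      by (auto simp: F_def covers_def u)
    moreover have "card \<dots> = d"
      using card_separating_sets[OF K, of A B s] that st by (auto simp: U_def u d_def k_def)
    ultimately show ?thesis by simp
  qed
  have "U \<noteq> {}" using U0 by auto
  from greedy_cover[of U F d covers, OF finU finF this deg d0]
  obtain G where G: "G \<subseteq> F" "real (card G) \<le> card F / d * (ln (card U) + 1)"
    and cov: "\<forall>u\<in>U. \<exists>S\<in>G. covers S u" by auto
  \<comment> \<open>There are at most \<open>4 ^ k\<close> pairs, so the logarithm costs a factor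
    linear in \<open>k\<close> and raises the exponent from 4 to 5.\<close>
  have "ln (card U) \<le> 2 * real k"
  proof -
    have choose_le: "n choose i \<le> 2 ^ k" if "n \<le> k" for n i
      by (rule order.trans[OF binomial_le_pow2 power_increasing[OF that]]) simp
    have "card U \<le> 2 ^ k * 2 ^ k" unfolding cardU by (intro mult_le_mono choose_le) auto
    then have "real (card U) \<le> 2 ^ k * 2 ^ k"
      using of_nat_mono[of "card U" "2 ^ k * 2 ^ k", where 'a = real] by simp
    then have "ln (card U) \<le> ln (2 ^ k * 2 ^ k)" using U0 by simp
    also have "\<dots> = 2 * (real k * ln 2)" by (simp add: ln_mult ln_realpow)
    also have "\<dots> \<le> 2 * (real k * 1)" using ln_2_less_1 by (intro mult_left_mono) auto
    finally show ?thesis by simp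
  qed
  then have ln: "ln (card U) + 1 \<le> 2 * (real k + 1)" by simp
  have "card F * ((s choose a) * (t choose b)) = card U * d"
    unfolding cardF cardU d_def using choose_mult_separating[OF st(2,3)] st(1) by simp
  then have "real (card F) * (f * g) = real (card U) * real d"
    unfolding f_def g_def by (metis of_nat_mult)
  then have ratio: "card F / d * (f + g) = card U * (1 / f + 1 / g)"
    using fg d0 by (simp add: field_simps)
  have "(\<Sum>S\<in>G. real (card S choose a) + real (card (K - S) choose b)) = (\<Sum>S\<in>G. f + g)"
  proof (intro sum.cong refl)
    fix S assume "S \<in> G"
    then have S: "S \<subseteq> K" "card S = s" using G(1) by (auto simp: F_def)
    then have "card (K - S) = t"
      using K finite_subset st(1) by (subst card_Diff_subset) (auto simp: k_def)
    with S show "real (card S choose a) + real (card (K - S) choose b) = f + g"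
      by (simp add: f_def g_def)
  qed
  also have "\<dots> = card G * (f + g)" by simp
  also have "\<dots> \<le> card F / d * (ln (card U) + 1) * (f + g)"
    using G(2) fg by (intro mult_right_mono) auto
  also have "\<dots> = (ln (card U) + 1) * (card F / d * (f + g))" by (simp only: mult_ac)
  also have "\<dots> \<le> (2 * (real k + 1)) * (2 * (real k + 1) ^ 4 * (9 / 4) ^ k)"
  proof (rule mult_mono[OF ln])
    show "card F / d * (f + g) \<le> 2 * (real k + 1) ^ 4 * (9 / 4) ^ k"
      unfolding ratio using cost by (simp add: cardU f_def g_def)
  qed (use fg in auto)
  also have "\<dots> = 4 * (real k + 1) ^ 5 * (9 / 4) ^ k"
    by (simp add: power_numeral_reduce)
  finally have "(\<Sum>S\<in>G. real (card S choose a) + real (card (K - S) choose b))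
      \<le> 4 * (real k + 1) ^ 5 * (9 / 4) ^ k" .
  moreover have "G \<subseteq> Pow K" using G(1) by (auto simp: F_def)
  moreover have "\<exists>S\<in>G. A \<subseteq> S \<and> B \<subseteq> K - S"
    if "A \<subseteq> K \<and> B \<subseteq> K \<and> A \<inter> B = {} \<and> card A = a \<and> card B = b" for A B
    using bspec[OF cov, of "(A, B)"] that by (auto simp: U_def covers_def)
  ultimately show ?thesis unfolding k_def by blast
qed

section \<open>Subsets as binary numbers and the final bound\<close>

lemma set_encode_less:
  assumes "A \<subseteq> {..<k}"
  shows "set_encode A < 2 ^ k"
proof -
  have "set_encode A \<le> (\<Sum>i<k. 2 ^ i)"
    unfolding set_encode_def using assms by (intro sum_mono2) auto
  also have "\<dots> < 2 ^ k" by (induction k) auto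
  finally show ?thesis .
qed

lemma set_decode_subset:
  assumes "i < 2 ^ k"
  shows "set_decode i \<subseteq> {..<k}"
proof
  fix b assume "b \<in> set_decode i"
  then have "i div 2 ^ b \<noteq> 0" by (auto simp: set_decode_def intro: gr0I)
  then have "2 ^ b \<le> i" by (simp add: div_eq_0_iff)
  then have "(2 :: nat) ^ b < 2 ^ k" using assms by (rule le_less_trans)
  then show "b \<in> {..<k}" by simp
qed

text \<open>The covers for all size pairs \<open>(a, b)\<close> with \<open>a + b \<le> k\<close>
  are united; at most \<open>(k + 1)^2\<close> such pairs raise the exponent from 5 to 7.\<close>

lemma OR2_disjointness_mat_le:
  "real (OR2 (disjointness_mat (2 ^ k))) \<le> 4 * (real k + 1) ^ 7 * (9 / 4) ^ k"
proof -
  define K where "K = {..<k}"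
  have K: "finite K" "card K = k" by (simp_all add: K_def)
  define P where "P = {(a, b). a + b \<le> k}"
  have P_sub: "P \<subseteq> {..k} \<times> {..k}" by (auto simp: P_def)
  then have finP: "finite P" by (rule finite_subset) auto
  have "card P \<le> card ({..k} \<times> {..k})" using P_sub by (intro card_mono) auto
  then have "card P \<le> (k + 1) * (k + 1)" by simp
  then have "real (card P) \<le> real ((k + 1) * (k + 1))" by (rule of_nat_mono)
  then have cardP: "real (card P) \<le> (real k + 1) * (real k + 1)" by (simp add: algebra_simps)
  \<comment> \<open>Bundles the conclusion of \<open>separating_family\<close>, so that one family
    can be chosen for each pair of sizes.\<close>
  define good where "good x G \<longleftrightarrow> G \<subseteq> Pow K \<and>
      (\<forall>A B. A \<subseteq> K \<and> B \<subseteq> K \<and> A \<inter> B = {} \<and> card A = fst x \<and> card B = snd x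
         \<longrightarrow> (\<exists>S\<in>G. A \<subseteq> S \<and> B \<subseteq> K - S)) \<and>
      (\<Sum>S\<in>G. real (card S choose fst x) + real (card (K - S) choose snd x))
        \<le> 4 * (real k + 1) ^ 5 * (9 / 4) ^ k" for x :: "nat \<times> nat" and G
  have "\<exists>G. good x G" if "x \<in> P" for x
    using separating_family[OF K(1), of "fst x" "snd x"] that
    unfolding K(2) by (simp only: good_def P_def mem_Collect_eq case_prod_beta)
  then obtain G where good: "good x (G x)" if "x \<in> P" for x by metis
  have G: "G x \<subseteq> Pow K" if "x \<in> P" for x
    using good[OF that] unfolding good_def by (elim conjE)
  have sep: "\<exists>S\<in>G x. A \<subseteq> S \<and> B \<subseteq> K - S"
    if "x \<in> P" "A \<subseteq> K" "B \<subseteq> K" "A \<inter> B = {}" "card A = fst x" "card B = snd x" for x A B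
  proof -
    have "\<forall>A B. A \<subseteq> K \<and> B \<subseteq> K \<and> A \<inter> B = {} \<and> card A = fst x \<and> card B = snd x
         \<longrightarrow> (\<exists>S\<in>G x. A \<subseteq> S \<and> B \<subseteq> K - S)"
      using good[OF that(1)] unfolding good_def by (elim conjE)
    then show ?thesis using that(2-) by (simp only: simp_thms)
  qed
  have cost: "(\<Sum>S\<in>G x. real (card S choose fst x) + real (card (K - S) choose snd x))
      \<le> 4 * (real k + 1) ^ 5 * (9 / 4) ^ k" if "x \<in> P" for x
    using good[OF that] unfolding good_def by (elim conjE)
  have finG: "finite (G x)" if "x \<in> P" for x
    using G[OF that] K(1) by (meson finite_Pow_iff finite_subset)
  define I where "I = Sigma P G"
  define R where "R = (\<lambda>(x :: nat \<times> nat, S). set_encode ` {A. A \<subseteq> S \<and> card A = fst x})"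
  define C where "C = (\<lambda>(x :: nat \<times> nat, S). set_encode ` {B. B \<subseteq> K - S \<and> card B = snd x})"
  have I_cases: "\<exists>x S. y = (x, S) \<and> x \<in> P \<and> S \<in> G x \<and> S \<subseteq> K" if "y \<in> I" for y
  proof -
    obtain x S where "y = (x, S)" "x \<in> P" "S \<in> G x" using \<open>y \<in> I\<close> by (auto simp: I_def)
    with G[of x] show ?thesis by blast
  qed
  have fin: "finite A" if "A \<subseteq> K" for A using that K(1) by (rule finite_subset)
  have "OR2 (disjointness_mat (2 ^ k)) \<le> (\<Sum>y\<in>I. card (R y) + card (C y))"
  proof (rule OR2_le_rectangle_cover)
    show "finite I" unfolding I_def using finP finG by auto
  next
    fix y assume "y \<in> I"
    then obtain x S where "y = (x, S)" "S \<subseteq> K" using I_cases by blast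
    then show "R y \<subseteq> {..<dim_row (disjointness_mat (2 ^ k))} \<and> C y \<subseteq> {..<dim_col (disjointness_mat (2 ^ k))}"
      by (auto simp: R_def C_def K_def disjointness_mat_def intro!: set_encode_less)
  next
    fix i j assume "i < dim_row (disjointness_mat (2 ^ k))" "j < dim_col (disjointness_mat (2 ^ k))"
    then have ij: "i < 2 ^ k" "j < 2 ^ k" by (auto simp: disjointness_mat_def)
    have entry: "disjointness_mat (2 ^ k) $$ (i, j) \<longleftrightarrow> set_decode i \<inter> set_decode j = {}"
      using ij by (auto simp: disjointness_mat_def set_decode_def bit_iff_odd)
    show "disjointness_mat (2 ^ k) $$ (i, j) \<longleftrightarrow> (\<exists>y\<in>I. i \<in> R y \<and> j \<in> C y)"
    proof
      assume "disjointness_mat (2 ^ k) $$ (i, j)"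
      then have disj: "set_decode i \<inter> set_decode j = {}" by (simp add: entry)
      have sub: "set_decode i \<subseteq> K" "set_decode j \<subseteq> K"
        using ij set_decode_subset by (auto simp: K_def)
      define x where "x = (card (set_decode i), card (set_decode j))"
      have "card (set_decode i \<union> set_decode j) \<le> card K"
        using sub K(1) by (intro card_mono) auto
      then have xP: "x \<in> P" using disj by (simp add: x_def P_def card_Un_disjoint K(2))
      obtain S where S: "S \<in> G x" "set_decode i \<subseteq> S" "set_decode j \<subseteq> K - S"
        using sep[OF xP sub disj] unfolding x_def fst_conv snd_conv by blast
      have "(x, S) \<in> I" using xP S(1) by (simp add: I_def)
      moreover have "i \<in> R (x, S)"
        unfolding R_def prod.case by (rule image_eqI[of _ _ "set_decode i"]) (use S in \<open>simp_all add: x_def\<close>)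
      moreover have "j \<in> C (x, S)"
        unfolding C_def prod.case by (rule image_eqI[of _ _ "set_decode j"]) (use S in \<open>simp_all add: x_def\<close>)
      ultimately show "\<exists>y\<in>I. i \<in> R y \<and> j \<in> C y" by blast
    next
      assume "\<exists>y\<in>I. i \<in> R y \<and> j \<in> C y"
      then obtain y where y: "y \<in> I" "i \<in> R y" "j \<in> C y" by blast
      obtain x S where xS: "y = (x, S)" "S \<subseteq> K" using I_cases[OF y(1)] by blast
      obtain A where A: "A \<subseteq> S" "i = set_encode A" using y(2) by (auto simp: xS(1) R_def)
      obtain B where B: "B \<subseteq> K - S" "j = set_encode B" using y(3) by (auto simp: xS(1) C_def)
      have "A \<subseteq> K" "B \<subseteq> K" using A(1) B(1) xS(2) by blast+
      then have "finite A" "finite B" by (simp_all add: fin)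
      moreover have "A \<inter> B = {}" using A(1) B(1) by blast
      ultimately show "disjointness_mat (2 ^ k) $$ (i, j)" unfolding entry by (simp add: A(2) B(2))
    qed
  qed
  also have "\<dots> = (\<Sum>x\<in>P. \<Sum>S\<in>G x. card (R (x, S)) + card (C (x, S)))"
    unfolding I_def using finP finG by (subst sum.Sigma) auto
  also have "\<dots> \<le> (\<Sum>x\<in>P. \<Sum>S\<in>G x. (card S choose fst x) + (card (K - S) choose snd x))"
  proof (intro sum_mono add_mono)
    fix x S assume "x \<in> P" "S \<in> G x"
    then have "S \<subseteq> K" using G by blast
    then have S: "finite S" "finite (K - S)" using K(1) fin by auto
    have "card (set_encode ` {A. A \<subseteq> X \<and> card A = n}) \<le> (card X choose n)" if "finite X" for X n
      using card_image_le[of "{A. A \<subseteq> X \<and> card A = n}" set_encode] that by (simp add: n_subsets)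
    with S show "card (R (x, S)) \<le> (card S choose fst x)" "card (C (x, S)) \<le> (card (K - S) choose snd x)"
      by (auto simp: R_def C_def)
  qed
  finally have "real (OR2 (disjointness_mat (2 ^ k)))
      \<le> real (\<Sum>x\<in>P. \<Sum>S\<in>G x. (card S choose fst x) + (card (K - S) choose snd x))"
    by (rule of_nat_mono)
  also have "\<dots> = (\<Sum>x\<in>P. \<Sum>S\<in>G x. real (card S choose fst x) + real (card (K - S) choose snd x))"
    by simp
  also have "\<dots> \<le> (\<Sum>x\<in>P. 4 * (real k + 1) ^ 5 * (9 / 4) ^ k)"
    by (intro sum_mono cost)
  also have "\<dots> = card P * (4 * (real k + 1) ^ 5 * (9 / 4) ^ k)" by simp
  also have "\<dots> \<le> ((real k + 1) * (real k + 1)) * (4 * (real k + 1) ^ 5 * (9 / 4) ^ k)"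
    using cardP by (intro mult_right_mono) auto
  also have "\<dots> = 4 * (real k + 1) ^ 7 * (9 / 4) ^ k" by (simp add: power_numeral_reduce)
  finally show ?thesis .
qed

theorem theorem8:
  "\<exists>c :: real. \<forall>k n :: nat. n = 2 ^ k \<longrightarrow>
     real (OR2 (disjointness_mat n)) \<le> real n powr log 2 (9 / 4) * (log 2 (real n) + 2) powr c"
proof (intro exI allI impI)
  fix k n :: nat assume n: "n = 2 ^ k"
  have log_n: "log 2 (real n) = real k" by (simp add: n log_nat_power)
  have "real n = 2 powr real k" by (simp add: n powr_realpow)
  then have "real n powr log 2 (9 / 4) = (2 powr log 2 (9 / 4)) powr real k"
    by (simp only: powr_powr mult.commute)
  also have "\<dots> = (9 / 4) ^ k" by (simp add: powr_realpow)
  finally have pow: "real n powr log 2 (9 / 4) = (9 / 4) ^ k" .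
  \<comment> \<open>The constant 4 is absorbed by \<open>(real k + 2)^2\<close>; together with the
    exponent 7 this gives 9, the witness for \<open>c\<close>.\<close>
  have "4 * (real k + 1) ^ 7 \<le> (real k + 2)\<^sup>2 * (real k + 2) ^ 7"
    using power_mono[of 2 "real k + 2" 2] by (intro mult_mono power_mono) auto
  also have "\<dots> = (real k + 2) powr 9"
    by (simp add: powr_numeral flip: power_add)
  finally have poly: "4 * (real k + 1) ^ 7 \<le> (real k + 2) powr 9" .
  have "real (OR2 (disjointness_mat n)) \<le> 4 * (real k + 1) ^ 7 * (9 / 4) ^ k"
    unfolding n by (rule OR2_disjointness_mat_le)
  also have "\<dots> \<le> (real k + 2) powr 9 * (9 / 4) ^ k"
    using poly by (rule mult_right_mono) simp
  finally show "real (OR2 (disjointness_mat n)) \<le> real n powr log 2 (9 / 4) * (log 2 (real n) + 2) powr 9"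
    unfolding pow log_n by (simp only: mult.commute)
qed

end
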